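(* Let $G$ be an $\alpha_1$-metric graph. For every pair of vertices $s,t$ of $G$ with $d(s,t)\ge 4$ there exists a vertex $c\in I(s,t)\setminus\{s,t\}$ such that $e(c)<\max\{e(s),e(t)\}$.
   Context: All graphs are finite, connected, unweighted, undirected, simple; $d(u,v)$ is the shortest-path distance. $I(u,v)=\{x: d(u,x)+d(x,v)=d(u,v)\}$. A graph is $\alpha_1$-metric if for all vertices $u,v,w,x$: whenever $v\in I(u,w)$, $w\in I(v,x)$ and $v,w$ are adjacent, then $d(u,x)\ge d(u,v)+d(v,x)-1$. The eccentricity is $e(v)=\max_u d(u,v)$. *)

theory Defs
  imports Main
begin

definition is_path :: "('a \<Rightarrow> 'a \<Rightarrow> bool) \<Rightarrow> 'a list \<Rightarrow> bool" where
  "is_path E p \<longleftrightarrow> p \<noteq> [] \<and> (\<forall>i < length p - 1. E (p ! i) (p ! Suc i))"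

definition connected_graph :: "'a set \<Rightarrow> ('a \<Rightarrow> 'a \<Rightarrow> bool) \<Rightarrow> bool" where
  "connected_graph V E \<longleftrightarrow>
     finite V \<and> V \<noteq> {} \<and>
     (\<forall>u v. E u v \<longrightarrow> u \<in> V \<and> v \<in> V) \<and>
     (\<forall>u v. E u v \<longrightarrow> E v u) \<and>
     (\<forall>u. \<not> E u u) \<and>
     (\<forall>u\<in>V. \<forall>v\<in>V. \<exists>p. is_path E p \<and> hd p = u \<and> last p = v)"

definition dist :: "('a \<Rightarrow> 'a \<Rightarrow> bool) \<Rightarrow> 'a \<Rightarrow> 'a \<Rightarrow> nat" where
  "dist E u v = (LEAST n. \<exists>p. is_path E p \<and> hd p = u \<and> last p = v \<and> length p = Suc n)"

definition interval :: "'a set \<Rightarrow> ('a \<Rightarrow> 'a \<Rightarrow> bool) \<Rightarrow> 'a \<Rightarrow> 'a \<Rightarrow> 'a set" where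
  "interval V E u v = {x \<in> V. dist E u x + dist E x v = dist E u v}"

definition alpha1_metric :: "'a set \<Rightarrow> ('a \<Rightarrow> 'a \<Rightarrow> bool) \<Rightarrow> bool" where
  "alpha1_metric V E \<longleftrightarrow>
     (\<forall>u\<in>V. \<forall>v\<in>V. \<forall>w\<in>V. \<forall>x\<in>V.
        v \<in> interval V E u w \<and> w \<in> interval V E v x \<and> E v w \<longrightarrow>
        int (dist E u x) \<ge> int (dist E u v) + int (dist E v x) - 1)"

definition ecc :: "'a set \<Rightarrow> ('a \<Rightarrow> 'a \<Rightarrow> bool) \<Rightarrow> 'a \<Rightarrow> nat" where
  "ecc V E v = Max ((\<lambda>u. dist E u v) ` V)"

end

theory Submission
  imports Defs
begin

text \<open>
  Disks are convex, so if no interior vertex of \<open>I(s,t)\<close> has eccentricity below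
  \<open>m = max (e(s)) (e(t))\<close>, they all have eccentricity exactly \<open>m\<close>.
  Among the vertices at distance 2 from \<open>s\<close> in \<open>I(s,t)\<close>, let \<open>c\<close> have the fewest vertices at
  distance \<open>m\<close>; let \<open>z\<close> be one of these and \<open>a\<close> a neighbour of \<open>c\<close> on the way to \<open>z\<close>.
  Then \<open>a\<close> again lies in \<open>I(s,t)\<close> at distance 2 from \<open>s\<close>, so by minimality there is \<open>z'\<close> at
  distance \<open>m\<close> from \<open>a\<close> and \<open>m - 1\<close> from \<open>c\<close>. Let \<open>b\<close> and \<open>b'\<close> be neighbours of \<open>s\<close> on the way
  to \<open>z\<close> and \<open>z'\<close>. One shows that \<open>b\<close> is adjacent to \<open>a\<close> but not to \<open>c\<close>, and \<open>b'\<close> to \<open>c\<close> but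
  not to \<open>a\<close>. Since the neighbours of \<open>s\<close> in \<open>I(s,t)\<close> form a clique,
  \<open>b, b', c, a\<close> is an induced 4-cycle, which an \<open>\<alpha>\<^sub>1\<close>-metric excludes.
\<close>

section \<open>Graph distance\<close>

text \<open>Composing relation powers replaces concatenating vertex lists, so the metric laws below
  can be read off \<open>E ^^ n\<close>.\<close>

lemma walk_iff_relpowp:
  "(\<exists>p. is_path E p \<and> hd p = u \<and> last p = v \<and> length p = Suc n) \<longleftrightarrow> (E ^^ n) u v"
proof (induction n arbitrary: v)
  case 0
  show ?case
  proof
    assume "\<exists>p. is_path E p \<and> hd p = u \<and> last p = v \<and> length p = Suc 0"
    then show "(E ^^ 0) u v" by (auto simp: length_Suc_conv)
  next
    assume "(E ^^ 0) u v"
    then show "\<exists>p. is_path E p \<and> hd p = u \<and> last p = v \<and> length p = Suc 0"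
      by (intro exI[of _ "[u]"]) (simp add: is_path_def)
  qed
next
  case (Suc n)
  show ?case
  proof
    assume "\<exists>p. is_path E p \<and> hd p = u \<and> last p = v \<and> length p = Suc (Suc n)"
    then obtain p where p: "is_path E p" "hd p = u" "last p = v" "length p = Suc (Suc n)"
      by blast
    define q where "q = butlast p"
    have len: "length q = Suc n" using p(4) by (simp add: q_def)
    then have q: "length q = Suc n" "q \<noteq> []" by auto
    have nth: "q ! i = p ! i" if "i < Suc n" for i
      using that q(1) by (simp add: q_def nth_butlast)
    have "is_path E q"
      using p(1,4) q nth by (auto simp: is_path_def)
    moreover have "hd q = u"
      using p(1,2) q nth[of 0] by (simp add: is_path_def hd_conv_nth)
    moreover have "last q = p ! n" using q nth[of n] by (simp add: last_conv_nth)
    ultimately have "(E ^^ n) u (p ! n)" using Suc.IH q(1) by blast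
    moreover have "E (p ! n) v"
      using p(1,3,4) last_conv_nth[of p] by (auto simp: is_path_def)
    ultimately show "(E ^^ Suc n) u v" by (rule relpowp_Suc_I)
  next
    assume "(E ^^ Suc n) u v"
    then obtain w where w: "(E ^^ n) u w" "E w v" by (auto elim: relpowp_Suc_E)
    then obtain q where q: "is_path E q" "hd q = u" "last q = w" "length q = Suc n"
      using Suc.IH by blast
    have "q ! n = w" using q by (metis diff_Suc_1 is_path_def last_conv_nth)
    then have "is_path E (q @ [v])"
      using q w(2) by (auto simp: is_path_def nth_append less_Suc_eq)
    moreover have "hd (q @ [v]) = u" using q by (auto simp: is_path_def)
    ultimately show "\<exists>p. is_path E p \<and> hd p = u \<and> last p = v \<and> length p = Suc (Suc n)"
      using q(4) by (intro exI[of _ "q @ [v]"]) simp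
  qed
qed

lemma dist_eq_Least_relpowp: "dist E u v = (LEAST n. (E ^^ n) u v)"
  by (simp add: dist_def walk_iff_relpowp)

lemma relpowp_sym:
  assumes "\<And>x y. E x y \<Longrightarrow> E y x" and "(E ^^ n) u v"
  shows "(E ^^ n) v u"
  using assms(2)
proof (induction n arbitrary: v)
  case (Suc n)
  then obtain w where "(E ^^ n) u w" "E w v" by (auto elim: relpowp_Suc_E)
  then show ?case using Suc.IH assms(1) relpowp_Suc_I2 by metis
qed simp

locale conn_graph =
  fixes V :: "'a set" and E :: "'a \<Rightarrow> 'a \<Rightarrow> bool"
  assumes connected: "connected_graph V E"
begin

abbreviation d where "d \<equiv> dist E"

lemma edge_sym: "E u v \<Longrightarrow> E v u"
  and edge_in_V: "E u v \<Longrightarrow> u \<in> V" "E u v \<Longrightarrow> v \<in> V"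
  and edge_irrefl: "\<not> E u u"
  and finite_V: "finite V"
  using connected by (auto simp: connected_graph_def)

lemma relpowp_dist:
  assumes "u \<in> V" "v \<in> V"
  shows "(E ^^ d u v) u v"
proof -
  obtain p where "is_path E p" "hd p = u" "last p = v"
    using connected assms unfolding connected_graph_def by blast
  moreover have "length p = Suc (length p - 1)"
    using \<open>is_path E p\<close> by (auto simp: is_path_def)
  ultimately have "(E ^^ (length p - 1)) u v" using walk_iff_relpowp by metis
  then show ?thesis unfolding dist_eq_Least_relpowp by (rule LeastI)
qed

lemma dist_le: "(E ^^ n) u v \<Longrightarrow> d u v \<le> n"
  unfolding dist_eq_Least_relpowp by (rule Least_le)

lemma dist_refl [simp]: "d u u = 0"
  using dist_le[of 0 u u] by simp

lemma dist_eq_0: "u \<in> V \<Longrightarrow> v \<in> V \<Longrightarrow> d u v = 0 \<Longrightarrow> u = v"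
  using relpowp_dist[of u v] by simp

lemma dist_sym:
  assumes "u \<in> V" "v \<in> V"
  shows "d u v = d v u"
  using dist_le relpowp_dist relpowp_sym[of E] edge_sym assms by (meson le_antisym)

lemma dist_triangle:
  assumes "u \<in> V" "v \<in> V" "w \<in> V"
  shows "d u w \<le> d u v + d v w"
proof -
  have "(E ^^ (d u v + d v w)) u w"
    unfolding relpowp_add using relpowp_dist assms by blast
  then show ?thesis by (rule dist_le)
qed

lemma edge_iff_dist: "u \<in> V \<Longrightarrow> v \<in> V \<Longrightarrow> E u v \<longleftrightarrow> d u v = 1"
  using relpowp_dist[of u v] dist_le[of 1 u v] edge_irrefl dist_eq_0[of u v]
  by (cases "d u v") auto

lemma dist_pred:
  assumes "u \<in> V" "v \<in> V" "d u v = n" "n > 0"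
  obtains w where "w \<in> V" "d u w + 1 = n" "d w v = 1"
proof -
  obtain k where k: "n = Suc k" using assms(4) gr0_implies_Suc by blast
  obtain w where w: "(E ^^ k) u w" "E w v"
    using relpowp_dist[OF assms(1,2)] assms(3) k by (auto elim: relpowp_Suc_E)
  have wV: "w \<in> V" using w(2) by (rule edge_in_V)
  have wv: "d w v = 1" using w(2) edge_iff_dist[OF wV assms(2)] by simp
  have "d u w + 1 = n"
    using dist_le[OF w(1)] dist_triangle[OF assms(1) wV assms(2)] assms(3) k wv by linarith
  then show ?thesis using that wV wv by blast
qed

lemma dist_le_ecc: "u \<in> V \<Longrightarrow> d u v \<le> ecc V E v"
  unfolding ecc_def using finite_V by (intro Max_ge) auto

lemma ecc_attained:
  assumes "v \<in> V"
  obtains u where "u \<in> V" "d u v = ecc V E v"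
proof -
  have "ecc V E v \<in> (\<lambda>u. d u v) ` V"
    unfolding ecc_def using finite_V assms by (intro Max_in) auto
  then show ?thesis using that by auto
qed

end

section \<open>Local structure of alpha-1-metrics\<close>

locale alpha1_graph = conn_graph +
  assumes alpha1: "alpha1_metric V E"
begin

text \<open>Each interval condition becomes a change of distance by one across the edge from
  \<open>v\<close> to \<open>w\<close>; moving the 1 to the right-hand side keeps the inequality in
  the natural numbers.\<close>

lemma alpha1_ineq:
  assumes "u \<in> V" "v \<in> V" "w \<in> V" "x \<in> V"
    and "d v w = 1" "d u w = d u v + 1" "d v x = d w x + 1"
  shows "d u v + d v x \<le> d u x + 1"
proof -
  have "v \<in> interval V E u w" "w \<in> interval V E v x" "E v w"
    using assms edge_iff_dist by (auto simp: interval_def)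
  then have "int (d u x) \<ge> int (d u v) + int (d v x) - 1"
    using alpha1 assms(1-4) unfolding alpha1_metric_def by blast
  then show ?thesis by linarith
qed

text \<open>Induction along a geodesic from \<open>u\<close>. If the distance to \<open>z\<close>
  rises from the predecessor \<open>y\<close> to \<open>x\<close>, the alpha-1 inequality forces it
  to keep growing towards \<open>v\<close>; the one unit it may lose is paid for by
  \<open>d x v > 0\<close>, so \<open>d z x \<le> d z v\<close>.\<close>

lemma disk_convex:
  assumes "z \<in> V" "u \<in> V" "v \<in> V" "x \<in> V" "d u x + d x v = d u v"
  shows "d z x \<le> max (d z u) (d z v)"
  using assms(4,5)
proof (induction "d u x" arbitrary: x)
  case 0
  then have "x = u" using dist_eq_0[of u x] assms(2) by simp
  then show ?case by simp
next
  case (Suc n)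
  note x = Suc.prems and ux = Suc.hyps(2)[symmetric]
  obtain y where y: "y \<in> V" "d u y = n" "d y x = 1"
    using dist_pred[OF assms(2) x(1) ux] by auto
  have yv: "d y v = d x v + 1"
    using dist_triangle[OF assms(2) y(1) assms(3)] dist_triangle[OF y(1) x(1) assms(3)]
      y(2,3) ux x(2) by linarith
  have IH: "d z y \<le> max (d z u) (d z v)"
    using Suc.hyps(1)[OF y(2)[symmetric] y(1)] y(2) yv ux x(2) by linarith
  have le: "d z x \<le> d z y + 1"
    using dist_triangle[OF assms(1) y(1) x(1)] y(3) by linarith
  show ?case
  proof (cases "d z x \<le> d z y \<or> x = v")
    case True
    then show ?thesis using IH by auto
  next
    case False
    then have zx: "d z x = d z y + 1" using le by linarith
    have "d x v \<noteq> 0" using False dist_eq_0 x(1) assms(3) by blast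
    moreover have "d z y + d y v \<le> d z v + 1"
      by (rule alpha1_ineq[OF assms(1) y(1) x(1) assms(3) y(3) zx yv])
    ultimately show ?thesis using zx yv by linarith
  qed
qed

text \<open>With both diagonals equal to 2, the geodesics \<open>u, v, w\<close> and
  \<open>v, w, x\<close> share an edge, which forces \<open>d u x \<ge> 2\<close>.\<close>

lemma no_induced_C4:
  assumes "u \<in> V" "v \<in> V" "w \<in> V" "x \<in> V"
    and "d u v = 1" "d v w = 1" "d w x = 1" "d u x = 1"
  shows "d u w \<noteq> 2 \<or> d v x \<noteq> 2"
  using alpha1_ineq[of u v w x] assms by auto

text \<open>If \<open>d x y = 2\<close>, the geodesic \<open>x, s, y\<close> overlaps one from
  \<open>s\<close> through \<open>y\<close> to \<open>t\<close> in an edge, so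
  \<open>d x t \<ge> d s t\<close>.\<close>

lemma forward_neighbours_clique:
  assumes "s \<in> V" "t \<in> V" "x \<in> V" "y \<in> V"
    and "d s x = 1" "d s y = 1" "d x t + 1 = d s t" "d y t + 1 = d s t"
  shows "d x y \<le> 1"
proof (rule ccontr)
  assume "\<not> d x y \<le> 1"
  moreover have "d x s = 1" using dist_sym[of x s] assms by simp
  ultimately have "d x y = 2" using dist_triangle[of x s y] assms by simp
  then show False using alpha1_ineq[of x s y t] assms \<open>d x s = 1\<close> by simp
qed

lemma common_neighbour:
  assumes "u \<in> V" "v \<in> V" "d u v = 2"
  obtains w where "w \<in> V" "d u w = 1" "d w v = 1"
  by (rule dist_pred[OF assms]) (use that in auto)

end

section \<open>The exchange configuration\<close>

text \<open>\<open>m\<close> will be the larger eccentricity of \<open>s\<close> and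
  \<open>t\<close>. The assumption \<open>bounded\<close> includes both ends of the interval, so it
  also bounds the distances to \<open>s\<close> and \<open>t\<close>.\<close>

locale far_interval = alpha1_graph +
  fixes s t :: 'a and m :: nat
  assumes sV: "s \<in> V" and tV: "t \<in> V" and far: "d s t \<ge> 4"
    and bounded: "\<And>z x. \<lbrakk>z \<in> V; x \<in> V; d s x + d x t = d s t\<rbrakk> \<Longrightarrow> d z x \<le> m"
    and m_pos: "m > 0"
begin

definition level2 :: "'a set" where
  "level2 = {x \<in> V. d s x = 2 \<and> d x t + 2 = d s t}"

lemma level2_nonempty: "level2 \<noteq> {}"
proof -
  \<comment> \<open>Walk back from \<open>t\<close> towards \<open>s\<close>: the induction is on
    the distance still to go from level \<open>k\<close> to \<open>t\<close>.\<close>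
  have "\<exists>x\<in>V. d s x = k \<and> d x t + k = d s t" if "k \<le> d s t" for k
    using that
  proof (induction "d s t - k" arbitrary: k)
    case 0
    then show ?case using tV by (intro bexI[of _ t]) auto
  next
    case (Suc n)
    then obtain x where x: "x \<in> V" "d s x = Suc k" "d x t + Suc k = d s t"
    proof -
      have "n = d s t - Suc k" "Suc k \<le> d s t" using Suc.hyps(2) by linarith+
      then show ?thesis using Suc.hyps(1) that by blast
    qed
    obtain y where y: "y \<in> V" "d s y = k" "d y x = 1"
      using dist_pred[OF sV x(1,2)] by auto
    then have "d y t + k = d s t"
      using x dist_triangle[OF y(1) x(1) tV] dist_triangle[OF sV y(1) tV] by linarith
    then show ?case using y by blast
  qed
  from this[of 2] show ?thesis using far by (fastforce simp: level2_def)
qed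

text \<open>Both ends are at distance at least 2 from \<open>c\<close>. If the step to
  \<open>x\<close> led away from one of them, the alpha-1 inequality would put that end at distance
  at least \<open>m + 1\<close> from \<open>z\<close>. So neither distance grows, and as their sum
  is at least \<open>d s t\<close>, both stay the same.\<close>

lemma toward_far_level2:
  assumes "c \<in> level2" "z \<in> V" "d z c = m" "x \<in> V" "d c x = 1" "d z x + 1 = m"
  shows "x \<in> level2"
proof -
  have c: "c \<in> V" "d s c = 2" "d c t + 2 = d s t" using assms(1) by (auto simp: level2_def)
  have sym: "d c z = m" "d x z + 1 = m" "d t c = d c t" "d t x = d x t"
    using dist_sym[of c z] dist_sym[of x z] dist_sym[of t c] dist_sym[of t x] assms c tV by simp_all
  have bd: "d s z \<le> m" "d t z \<le> m"
    using bounded[of z s] bounded[of z t] dist_sym[of s z] dist_sym[of t z] assms sV tV by simp_all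
  have "d s x \<noteq> 3"
    using alpha1_ineq[of s c x z] assms c sym bd sV by auto
  moreover have "d t x \<noteq> d t c + 1"
    using alpha1_ineq[of t c x z] assms c sym bd tV far by auto
  moreover have "d s x \<le> 3" using dist_triangle[of s c x] assms c sV by simp
  moreover have "d t x \<le> d t c + 1" using dist_triangle[of t c x] assms c tV by simp
  moreover have "d s t \<le> d s x + d x t" using dist_triangle assms sV tV by simp
  ultimately show ?thesis using assms c sym by (simp add: level2_def)
qed

text \<open>If \<open>p\<close> were closer to \<open>z\<close> than \<open>c\<close> is, the
  alpha-1 inequality at the edge from \<open>p\<close> to \<open>c\<close> would give
  \<open>d z t \<ge> m + d s t - 3 > m\<close>; this needs \<open>d s t \<ge> 4\<close>. The edge
  from \<open>s\<close> to \<open>p\<close> is treated likewise.\<close>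

lemma far_on_left:
  assumes "c \<in> level2" "z \<in> V" "d z c = m" "p \<in> V" "d s p = 1" "d p c = 1"
  shows "d z p = m" and "d z s = m"
proof -
  have c: "c \<in> V" "d s c = 2" "d c t + 2 = d s t" using assms(1) by (auto simp: level2_def)
  have pt: "d p t + 1 = d s t"
    using dist_triangle[of s p t] dist_triangle[of p c t] assms c sV tV by simp
  have bd: "d z t \<le> m" "d z s \<le> m" "d z p \<le> m"
    using bounded[of z t] bounded[of z s] bounded[of z p] assms pt sV tV by simp_all
  have "d z p \<noteq> m - 1"
    using alpha1_ineq[of z p c t] assms c pt bd tV far m_pos by auto
  moreover have "m \<le> d z p + 1" using dist_triangle[of z p c] assms c by simp
  ultimately show zp: "d z p = m" using bd by simp
  have "d z s \<noteq> m - 1"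
    using alpha1_ineq[of z s p t] assms zp pt bd sV tV far m_pos by auto
  moreover have "m \<le> d z s + 1" using dist_triangle[of z s p] assms zp sV by simp
  ultimately show "d z s = m" using bd by simp
qed

text \<open>Neighbours \<open>q\<close> of \<open>c\<close> and \<open>r\<close> of \<open>a\<close>
  on the way to \<open>s\<close> are equal or adjacent; if neither serves both vertices,
  \<open>q, c, a, r\<close> is an induced 4-cycle.\<close>

lemma common_left_neighbour:
  assumes "c \<in> level2" "a \<in> level2" "d c a = 1"
  obtains p where "p \<in> V" "d s p = 1" "d p c = 1" "d p a = 1"
proof -
  have c: "c \<in> V" "d s c = 2" "d c t + 2 = d s t" using assms(1) by (auto simp: level2_def)
  have a: "a \<in> V" "d s a = 2" "d a t + 2 = d s t" using assms(2) by (auto simp: level2_def)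
  obtain q where q: "q \<in> V" "d s q = 1" "d q c = 1" using common_neighbour[OF sV c(1,2)] by blast
  obtain r where r: "r \<in> V" "d s r = 1" "d r a = 1" using common_neighbour[OF sV a(1,2)] by blast
  have "d q t + 1 = d s t"
    using dist_triangle[of s q t] dist_triangle[of q c t] q c sV tV by simp
  moreover have "d r t + 1 = d s t"
    using dist_triangle[of s r t] dist_triangle[of r a t] r a sV tV by simp
  ultimately have qr: "d q r \<le> 1" using forward_neighbours_clique q r sV tV by blast
  show ?thesis
  proof (cases "q = r \<or> d q a = 1 \<or> d r c = 1")
    case True
    then show ?thesis using that q r by auto
  next
    case False
    then have qr1: "d q r = 1" using qr q r dist_eq_0[of q r] by linarith
    have "d q a \<noteq> 0" "d r c \<noteq> 0" using dist_eq_0 q r c a by force+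
    moreover have "d q a \<le> 2" using dist_triangle[of q c a] assms q c a by simp
    moreover have "d r c \<le> 2"
      using dist_triangle[of r q c] dist_sym[of r q] qr1 q r c by simp
    ultimately have "d q a = 2" "d r c = 2" using False by auto
    then show ?thesis
      using no_induced_C4[of q c a r] dist_sym[of r c] dist_sym[of r a] assms qr1 q r c a by simp
  qed
qed

text \<open>\<open>b\<close> is the step from \<open>s\<close> towards \<open>z\<close>. Once
  \<open>b\<close> is adjacent to the common left neighbour \<open>p\<close>,
  \<open>d b a = 2\<close> would place \<open>p\<close> between \<open>b\<close> and
  \<open>a\<close>, against convexity of the disk of radius \<open>m - 1\<close> around
  \<open>z\<close>.\<close>

lemma left_neighbour_toward_far:
  assumes "c \<in> level2" "a \<in> level2" "d c a = 1" "z \<in> V" "d z c = m" "d z a + 1 = m"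
  obtains b where "b \<in> V" "d s b = 1" "d b a = 1" "d b c = 2"
proof -
  have c: "c \<in> V" "d s c = 2" "d c t + 2 = d s t" using assms(1) by (auto simp: level2_def)
  have a: "a \<in> V" "d s a = 2" "d a t + 2 = d s t" using assms(2) by (auto simp: level2_def)
  obtain p where p: "p \<in> V" "d s p = 1" "d p c = 1" "d p a = 1"
    using common_left_neighbour[OF assms(1-3)] by blast
  have zp: "d z p = m" and zs: "d z s = m" using far_on_left[OF assms(1,4,5) p(1-3)] by simp_all
  obtain b where b: "b \<in> V" "d z b + 1 = m" "d b s = 1"
    using dist_pred[OF assms(4) sV zs m_pos] by blast
  have sb: "d s b = 1" using b(3) dist_sym[OF sV b(1)] by simp
  have pt: "d p t + 1 = d s t"
    using dist_triangle[of s p t] dist_triangle[of p c t] p c sV tV by simp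
  have zc: "d c z = m" and zs': "d s z = m" and zb: "d b z + 1 = m" and cs: "d c s = 2"
    using dist_sym[OF c(1) assms(4)] dist_sym[OF sV assms(4)] dist_sym[OF b(1) assms(4)]
      dist_sym[OF c(1) sV] assms(5) zs b(2) c(2) by linarith+
  have nbc: "d b c \<noteq> 1" using far_on_left(1)[OF assms(1,4,5) b(1) sb] b(2) by linarith
  have bc: "d b c = 2"
  proof -
    have "d c b \<noteq> 3"
      using alpha1_ineq[OF c(1) sV b(1) assms(4) sb] zc zs' zb cs by linarith
    moreover have "d c b \<le> 3" using dist_triangle[OF c(1) sV b(1)] sb cs by linarith
    moreover have "d b c \<noteq> 0" using dist_eq_0[of b c] b c sb by fastforce
    ultimately show ?thesis using nbc dist_sym[OF b(1) c(1)] by linarith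
  qed
  have bp: "d b p = 1"
  proof (rule ccontr)
    \<comment> \<open>By the clique property \<open>b\<close> is then no closer to \<open>t\<close>
      than \<open>s\<close> is. It turns out that \<open>d b t = d s t\<close>, with
      \<open>a\<close> and \<open>c\<close> at distance 2 from \<open>b\<close>, so \<open>b\<close>
      can play the role of \<open>s\<close>: its neighbours \<open>w\<close> and \<open>r\<close>
      towards \<open>a\<close> and \<open>c\<close> close an induced 4-cycle
      \<open>r, c, a, w\<close>.\<close>
    assume nbp: "d b p \<noteq> 1"
    have "d b p \<noteq> 0" using dist_eq_0[OF b(1) p(1)] b(2) zp by fastforce
    with nbp have bp': "\<not> d b p \<le> 1" by simp
    have bt: "d b t \<ge> d s t"
    proof (rule ccontr)
      assume "\<not> ?thesis"
      then have "d b t + 1 = d s t" using dist_triangle[OF sV b(1) tV] sb by linarith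
      then show False using forward_neighbours_clique[of s t b p] b p sb pt sV tV bp' by blast
    qed
    have ba3: "d b a \<le> 3" using dist_triangle[OF b(1) sV a(1)] b(3) a(2) by linarith
    have "d b a \<noteq> 3" using disk_convex[OF assms(4) b(1) a(1) sV] assms(6) b(2,3) a(2) zs by linarith
    with ba3 have ba: "d b a = 2" and btn: "d b t = d s t"
      using dist_triangle[OF b(1) a(1) tV] bt a(3) by linarith+
    obtain w where w: "w \<in> V" "d b w = 1" "d w a = 1" using common_neighbour[OF b(1) a(1) ba] by blast
    obtain r where r: "r \<in> V" "d b r = 1" "d r c = 1" using common_neighbour[OF b(1) c(1) bc] by blast
    have wt: "d w t + 1 = d s t"
      using dist_triangle[OF b(1) w(1) tV] dist_triangle[OF w(1) a(1) tV] w(2,3) a(3) btn by linarith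
    have rt: "d r t + 1 = d s t"
      using dist_triangle[OF b(1) r(1) tV] dist_triangle[OF r(1) c(1) tV] r(2,3) c(3) btn by linarith
    \<comment> \<open>A neighbour of \<open>c\<close> closer to \<open>z\<close> stays in
      \<open>level2\<close>, hence is at distance \<open>d s t - 2\<close> from
      \<open>t\<close>.\<close>
    have not_down: "d z x + 1 \<noteq> m" if "x \<in> V" "d c x = 1" "d x t + 1 = d s t" for x
      using toward_far_level2[of c z x] assms that by (auto simp: level2_def)
    have cr: "d c r = 1" using r c dist_sym[of c r] by simp
    have "d z r \<le> m" using disk_convex[OF assms(4) b(1) c(1) r(1)] assms(5) b(2) r(2,3) bc by linarith
    moreover have "m \<le> d z r + 1" using dist_triangle[OF assms(4) r(1) c(1)] assms(5) r(3) by linarith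
    ultimately have zr: "d z r = m" using not_down[OF r(1) cr rt] by linarith
    have zw: "d z w + 1 \<le> m" using disk_convex[OF assms(4) b(1) a(1) w(1)] assms(6) b(2) w(2,3) ba by linarith
    have "d r a \<noteq> 1" using disk_convex[OF assms(4) b(1) a(1) r(1)] assms(6) b(2) r(2) ba zr by linarith
    moreover have "d r a \<noteq> 0" using dist_eq_0[of r a] r a rt by fastforce
    moreover have "d r a \<le> 2" using dist_triangle[OF r(1) c(1) a(1)] assms(3) r(3) by linarith
    ultimately have ra: "d r a = 2" by simp
    have "d w r \<le> 1" using forward_neighbours_clique[OF b(1) tV w(1) r(1)] w(2) r(2) wt rt btn by simp
    moreover have "d w r \<noteq> 0" using dist_eq_0[OF w(1) r(1)] zr zw by fastforce
    ultimately have rw: "d r w = 1" using dist_sym[OF r(1) w(1)] by linarith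
    have "d c w \<noteq> 1"
    proof
      assume cw: "d c w = 1"
      then have "m \<le> d z w + 1"
        using dist_triangle[OF assms(4) w(1) c(1)] dist_sym[OF w(1) c(1)] assms(5) by linarith
      then show False using not_down[OF w(1) cw wt] zw by linarith
    qed
    moreover have "d c w \<noteq> 0" using dist_eq_0[of c w] w c wt by fastforce
    moreover have "d c w \<le> 2"
      using dist_triangle[OF c(1) a(1) w(1)] dist_sym[OF w(1) a(1)] assms(3) w(3) by linarith
    ultimately have "d c w = 2" by simp
    then show False
      using no_induced_C4[OF r(1) c(1) a(1) w(1) r(3) assms(3)] w(3) ra rw dist_sym[OF w(1) a(1)] by simp
  qed
  have "d b a \<noteq> 2" using disk_convex[OF assms(4) b(1) a(1) p(1)] assms(6) b(2) p(4) bp zp by linarith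
  moreover have "d b a \<noteq> 0" using dist_eq_0[OF b(1) a(1)] a(2) sb by fastforce
  moreover have "d b a \<le> 2" using dist_triangle[OF b(1) p(1) a(1)] p(4) bp by linarith
  ultimately have "d b a = 1" by simp
  then show ?thesis using that b sb bc by blast
qed

lemma no_exchange:
  assumes "c \<in> level2" "a \<in> level2" "d c a = 1" "z \<in> V" "z' \<in> V"
    and "d z c = m" "d z a + 1 = m" "d z' a = m" "d z' c + 1 = m"
  shows False
proof -
  have c: "c \<in> V" "d s c = 2" "d c t + 2 = d s t" using assms(1) by (auto simp: level2_def)
  have a: "a \<in> V" "d s a = 2" "d a t + 2 = d s t" using assms(2) by (auto simp: level2_def)
  have ac: "d a c = 1" using assms c a dist_sym[of a c] by simp
  obtain b where b: "b \<in> V" "d s b = 1" "d b a = 1" "d b c = 2"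
    using left_neighbour_toward_far[OF assms(1-4,6,7)] by blast
  \<comment> \<open>The configuration is symmetric under exchanging \<open>c, z\<close> with
    \<open>a, z'\<close>.\<close>
  obtain b' where b': "b' \<in> V" "d s b' = 1" "d b' c = 1" "d b' a = 2"
    using left_neighbour_toward_far[OF assms(2,1) ac assms(5,8,9)] by blast
  have "d b t + 1 = d s t"
    using dist_triangle[of s b t] dist_triangle[of b a t] b a sV tV by simp
  moreover have "d b' t + 1 = d s t"
    using dist_triangle[of s b' t] dist_triangle[of b' c t] b' c sV tV by simp
  ultimately have "d b b' \<le> 1" using forward_neighbours_clique b b' sV tV by blast
  moreover have "d b b' \<noteq> 0" using dist_eq_0[of b b'] b b' by fastforce
  ultimately have "d b b' = 1" by simp
  then show False
    using no_induced_C4[of b b' c a] b b' c a assms(3) by simp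
qed

lemma exists_small_ecc: "\<exists>c \<in> level2. ecc V E c < m"
proof (rule ccontr)
  assume contra: "\<not> ?thesis"
  define F where "F x = {v \<in> V. d v x = m}" for x
  have le: "d v x \<le> m" if "v \<in> V" "x \<in> level2" for v x
    using bounded[of v x] that by (simp add: level2_def)
  have F_ne: "F x \<noteq> {}" if x: "x \<in> level2" for x
  proof -
    obtain v where "v \<in> V" "d v x = ecc V E x"
      using ecc_attained x unfolding level2_def by blast
    then have "v \<in> F x" using contra x le[of v x] by (force simp: F_def)
    then show ?thesis by blast
  qed
  obtain c where c: "c \<in> level2" and min: "\<And>x. x \<in> level2 \<Longrightarrow> card (F c) \<le> card (F x)"
    using level2_nonempty ex_has_least_nat[of "\<lambda>x. x \<in> level2" _ "\<lambda>x. card (F x)"] by blast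
  have cV: "c \<in> V" using c by (simp add: level2_def)
  obtain z where z: "z \<in> V" "d z c = m" using F_ne[OF c] by (auto simp: F_def)
  obtain a where a: "a \<in> V" "d z a + 1 = m" "d a c = 1"
    using dist_pred[OF z(1) cV z(2) m_pos] by blast
  have ca: "d c a = 1" using a cV dist_sym[of c a] by simp
  have al: "a \<in> level2" using toward_far_level2 c z a ca by blast
  \<comment> \<open>The vertex \<open>z\<close> leaves the far set on passing from \<open>c\<close>
    to \<open>a\<close>, so by minimality some \<open>z'\<close> must enter it.\<close>
  have "\<not> F a \<subseteq> F c"
  proof
    assume "F a \<subseteq> F c"
    moreover have "z \<in> F c" "z \<notin> F a" using z a by (auto simp: F_def)
    ultimately have "card (F a) < card (F c)"
      using finite_V by (intro psubset_card_mono) (auto simp: F_def)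
    then show False using min[OF al] by simp
  qed
  then obtain z' where z': "z' \<in> V" "d z' a = m" "d z' c \<noteq> m" by (auto simp: F_def)
  have "d z' c + 1 = m"
    using le[of z' c] dist_triangle[of z' c a] z' c cV a ca by simp
  then show False using no_exchange[of c a z z'] c al ca z z' a by blast
qed

end

theorem theorem7:
  assumes "connected_graph V E"
    and "alpha1_metric V E"
    and "s \<in> V" and "t \<in> V"
    and "dist E s t \<ge> 4"
  shows "\<exists>c \<in> interval V E s t - {s, t}. ecc V E c < max (ecc V E s) (ecc V E t)"
proof -
  interpret alpha1_graph V E using assms by unfold_locales
  let ?m = "max (ecc V E s) (ecc V E t)"
  have "d z x \<le> ?m" if "z \<in> V" "x \<in> V" "d s x + d x t = d s t" for z x
    using disk_convex[of z s t x] dist_le_ecc[of z s] dist_le_ecc[of z t] that assms by simp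
  \<comment> \<open>The eccentricity of \<open>t\<close> is at least
    \<open>d s t \<ge> 4\<close>.\<close>
  moreover have "?m > 0" using dist_le_ecc[of s t] assms by simp
  ultimately interpret far_interval V E s t ?m
    using assms by unfold_locales
  obtain c where c: "c \<in> level2" "ecc V E c < ?m" using exists_small_ecc by blast
  then have "c \<in> interval V E s t - {s, t}"
    using assms(5) by (auto simp: level2_def interval_def)
  then show ?thesis using c by blast
qed

end
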